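(* There are no blue $K_5$'s in $\mathrm{Exoo}(42)$.
   Context: $\mathrm{Cyclic}(43)$ is the red/blue edge colouring of the complete graph $K_{43}$ on vertices $0,1,\dots,42$ (labels read modulo $43$) defined as follows. For distinct vertices $a,b$, the distance $\mathrm{d}(a,b)$ is the unique $m\in\{1,\dots,21\}$ with $a-b\equiv m$ or $b-a\equiv m \pmod{43}$. The edge between $a$ and $b$ is red if $\mathrm{d}(a,b)\in\{1,2,7,10,12,13,14,16,18,20,21\}$ and blue if $\mathrm{d}(a,b)\in\{3,4,5,6,8,9,11,15,17,19\}$. Write $\mathrm{e}(u,v)$ for the edge between $u$ and $v$. $\mathrm{Exoo}(42)$ is the coloured complete graph on the vertices $1,\dots,42$ obtained from $\mathrm{Cyclic}(43)$ by deleting vertex $0$ (and all edges at it) and changing the colour, from red to blue, of the following sixteen edges: $\mathrm{e}(11,32)$ and $\mathrm{e}(a,a+1)$ for $a\in\{4,5,6,7,13,14,15,16,23,24,30,33,39,40,41\}$. A blue $K_5$ is a set of five distinct vertices all ten of whose edges are blue. *)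

theory Defs
  imports "HOL-Number_Theory.Cong"
begin

(* Edges are two-element sets of vertices. *)
record 'a two_coloured_graph =
  vertices :: "'a set"
  red :: "'a set set"
  blue :: "'a set set"

definition complete_two_coloured :: "'a two_coloured_graph \<Rightarrow> bool" where
  "complete_two_coloured G \<longleftrightarrow>
     red G \<union> blue G = {{a, b} |a b. a \<in> vertices G \<and> b \<in> vertices G \<and> a \<noteq> b} \<and>
     red G \<inter> blue G = {}"

definition delete_vertex :: "'a \<Rightarrow> 'a two_coloured_graph \<Rightarrow> 'a two_coloured_graph" where
  "delete_vertex v G =
     \<lparr>vertices = vertices G - {v}, red = {e \<in> red G. v \<notin> e}, blue = {e \<in> blue G. v \<notin> e}\<rparr>"

(* Meaningful for F a subset of red G. *)
definition recolour_blue :: "'a set set \<Rightarrow> 'a two_coloured_graph \<Rightarrow> 'a two_coloured_graph" where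
  "recolour_blue F G = \<lparr>vertices = vertices G, red = red G - F, blue = blue G \<union> F\<rparr>"

definition is_blue_K5 :: "'a two_coloured_graph \<Rightarrow> 'a set \<Rightarrow> bool" where
  "is_blue_K5 G S \<longleftrightarrow>
     S \<subseteq> vertices G \<and> card S = 5 \<and> (\<forall>u\<in>S. \<forall>v\<in>S. u \<noteq> v \<longrightarrow> {u, v} \<in> blue G)"

definition dist43 :: "int \<Rightarrow> int \<Rightarrow> int" where
  "dist43 a b = (THE m. m \<in> {1..21} \<and> ([a - b = m] (mod 43) \<or> [b - a = m] (mod 43)))"

definition edges43 :: "int set \<Rightarrow> int set set" where
  "edges43 D = {{a, b} |a b. a \<in> {0..42} \<and> b \<in> {0..42} \<and> a \<noteq> b \<and> dist43 a b \<in> D}"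

definition cyclic43 :: "int two_coloured_graph" where
  "cyclic43 =
     \<lparr>vertices = {0..42},
      red = edges43 {1, 2, 7, 10, 12, 13, 14, 16, 18, 20, 21},
      blue = edges43 {3, 4, 5, 6, 8, 9, 11, 15, 17, 19}\<rparr>"

definition exoo42_recoloured :: "int set set" where
  "exoo42_recoloured =
     insert {11, 32}
       ((\<lambda>a. {a, a + 1}) ` {4, 5, 6, 7, 13, 14, 15, 16, 23, 24, 30, 33, 39, 40, 41})"

definition exoo42 :: "int two_coloured_graph" where
  "exoo42 = recolour_blue exoo42_recoloured (delete_vertex 0 cyclic43)"

lemma dist43_characterization:
  fixes m :: int
  assumes "a \<in> {0..42}" "b \<in> {0..42}" "a \<noteq> b"
  shows "m \<in> {1..21} \<and> ([a - b = m] (mod 43) \<or> [b - a = m] (mod 43)) \<longleftrightarrow>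
    m = min \<bar>a - b\<bar> (43 - \<bar>a - b\<bar>)"
proof
  have *: "x = m \<or> x = m - 43"
    if x: "[x = m] (mod 43)" "m \<in> {1..21}" "-42 \<le> x" "x \<le> 42" for x :: int
  proof -
    obtain k where k: "x - m = 43 * k"
      using x(1) unfolding cong_iff_dvd_diff by (elim dvdE)
    then have "43 * k < 43" "- 86 < 43 * k" using x(2-4) by auto
    then have "k = 0 \<or> k = - 1" by linarith
    then show ?thesis using k by auto
  qed
  assume "m \<in> {1..21} \<and> ([a - b = m] (mod 43) \<or> [b - a = m] (mod 43))"
  then show "m = min \<bar>a - b\<bar> (43 - \<bar>a - b\<bar>)"
    using *[of "a - b"] *[of "b - a"] assms by auto
next
  assume m: "m = min \<bar>a - b\<bar> (43 - \<bar>a - b\<bar>)"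
  then consider "a - b = m" | "b - a = m" | "a - b = m - 43" | "b - a = m - 43"
    by linarith
  then have "[a - b = m] (mod 43) \<or> [b - a = m] (mod 43)"
    by cases (auto simp: cong_iff_dvd_diff)
  then show "m \<in> {1..21} \<and> ([a - b = m] (mod 43) \<or> [b - a = m] (mod 43))"
    using m assms by auto
qed

lemma dist43_eq:
  assumes "a \<in> {0..42}" "b \<in> {0..42}" "a \<noteq> b"
  shows "dist43 a b = min \<bar>a - b\<bar> (43 - \<bar>a - b\<bar>)"
  unfolding dist43_def dist43_characterization[OF assms] by simp

lemma edges43_iff:
  assumes "a \<in> {0..42}" "b \<in> {0..42}" "a \<noteq> b"
  shows "{a, b} \<in> edges43 D \<longleftrightarrow> min \<bar>a - b\<bar> (43 - \<bar>a - b\<bar>) \<in> D"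
proof -
  have "dist43 b a = dist43 a b"
    using assms by (simp add: dist43_eq abs_minus_commute)
  then have "{a, b} \<in> edges43 D \<longleftrightarrow> dist43 a b \<in> D"
    using assms unfolding edges43_def mem_Collect_eq doubleton_eq_iff by metis
  then show ?thesis using dist43_eq[OF assms] by simp
qed

lemma exoo42_recoloured_red: "exoo42_recoloured \<subseteq> red (delete_vertex 0 cyclic43)"
  unfolding exoo42_recoloured_def delete_vertex_def cyclic43_def by (simp add: edges43_iff)

lemma card_exoo42_recoloured: "card exoo42_recoloured = 16"
  unfolding exoo42_recoloured_def by (simp add: doubleton_eq_iff)

lemma vertices_exoo42: "vertices exoo42 = {1..42}"
  unfolding exoo42_def recolour_blue_def delete_vertex_def cyclic43_def by auto

lemma complete_two_coloured_cyclic43: "complete_two_coloured cyclic43"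
proof -
  let ?R = "{1, 2, 7, 10, 12, 13, 14, 16, 18, 20, 21} :: int set"
  let ?B = "{3, 4, 5, 6, 8, 9, 11, 15, 17, 19} :: int set"
  have part: "dist43 a b \<in> ?R \<or> dist43 a b \<in> ?B"
    if "a \<in> {0..42}" "b \<in> {0..42}" "a \<noteq> b" for a b
  proof -
    have "dist43 a b \<in> {1..21}"
      using that unfolding dist43_eq[OF that] by (auto simp: min_def abs_if)
    then have "dist43 a b \<in> set [1..21]" by (simp only: set_upto)
    then show ?thesis by (simp add: upto.simps[of 1 21] del: set_upto) blast
  qed
  have un: "edges43 ?R \<union> edges43 ?B = {{a, b} |a b. a \<in> {0..42} \<and> b \<in> {0..42} \<and> a \<noteq> b}"
    using part unfolding edges43_def by blast
  have disj: "?R \<inter> ?B = {}" by simp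
  have int: "edges43 ?R \<inter> edges43 ?B = {}"
  proof (rule equals0I)
    fix e assume e: "e \<in> edges43 ?R \<inter> edges43 ?B"
    then obtain a b where ab: "a \<in> {0..42}" "b \<in> {0..42}" "a \<noteq> b" "e = {a, b}"
      unfolding edges43_def by blast
    show False
      using e disj unfolding ab(4) Int_iff edges43_iff[OF ab(1-3)] by blast
  qed
  show ?thesis
    unfolding complete_two_coloured_def cyclic43_def two_coloured_graph.simps
    using un int by (rule conjI)
qed

lemma complete_two_coloured_delete_vertex:
  assumes "complete_two_coloured G"
  shows "complete_two_coloured (delete_vertex v G)"
proof -
  have un: "red G \<union> blue G = {{a, b} |a b. a \<in> vertices G \<and> b \<in> vertices G \<and> a \<noteq> b}"
    and int: "red G \<inter> blue G = {}"
    using assms unfolding complete_two_coloured_def by simp_all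
  have "{e \<in> red G. v \<notin> e} \<union> {e \<in> blue G. v \<notin> e} = {e \<in> red G \<union> blue G. v \<notin> e}"
    by blast
  also have "\<dots> = {{a, b} |a b. a \<in> vertices G - {v} \<and> b \<in> vertices G - {v} \<and> a \<noteq> b}"
    unfolding un by blast
  finally show ?thesis
    using int unfolding complete_two_coloured_def delete_vertex_def two_coloured_graph.simps
    by blast
qed

lemma complete_two_coloured_recolour_blue:
  assumes "complete_two_coloured G" "F \<subseteq> red G"
  shows "complete_two_coloured (recolour_blue F G)"
proof -
  have "(red G - F) \<union> (blue G \<union> F) = red G \<union> blue G"
    using assms(2) by blast
  moreover have "(red G - F) \<inter> (blue G \<union> F) = {}"
    using assms unfolding complete_two_coloured_def by blast
  ultimately show ?thesis
    using assms(1) unfolding complete_two_coloured_def recolour_blue_def by simp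
qed

lemma complete_two_coloured_exoo42: "complete_two_coloured exoo42"
  unfolding exoo42_def
  by (intro complete_two_coloured_recolour_blue complete_two_coloured_delete_vertex
      complete_two_coloured_cyclic43 exoo42_recoloured_red)

end

theory Submission
  imports Defs
begin

text \<open>
  The reason is that the recoloured edges hardly interact with each other. Call a vertex pair
  \<^emph>\<open>cyclically blue\<close> if it is blue in Cyclic(43), and let S be a blue K5 in Exoo(42).

  Two different recoloured edges never lie in the same blue clique
  (lemma \<open>recoloured_pairs_isolated\<close>). If {a, a+1} and {c, c+1} did, put k = c - a mod 43. For
  k = 1, 2, -1, -2, two of the endpoints have the red distance 2. Otherwise the four pairs between
  the two edges are cyclically blue, so k - 1, k and k + 1 are all blue distances up to sign. This
  leaves k = 4, 5, -4, -5, and no two of the chosen left endpoints differ by that much. No other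
  recoloured edge meets {11, 32}, and the common blue neighbours of 11 and 32 contain no two
  consecutive vertices.

  So S contains at most one recoloured edge, and all its other edges are cyclically blue. A rotation
  by -a moves a vertex a of S to 0, and a recoloured edge {a, a+1} or {11, 32} to {0, 1} or
  {0, 21}. Since Cyclic(43) is invariant under rotation, three configurations are left. If S has
  no recoloured edge, its other vertices form a blue K4 in the blue neighbourhood of 0, which has 20
  vertices and contains none (lemma \<open>no_blue_K4_around_vertex\<close>). Otherwise its other vertices form a
  blue triangle in the common blue neighbourhood of 0 and 1, or of 0 and 21. The first one is
  bipartite with the parts {4, 5, 6, 35} and {9, 38, 39, 40}. The second one becomes bipartite, with
  the parts {4, 6, 24, 26} and {15, 17, 38, 40}, once 32 is removed; and 32 = 0 - 11 mod 43 is where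
  the rotation takes the deleted vertex 0. With vertex 0 present, {0, 6, 11, 17, 32} would be a blue
  K5, so recolouring {11, 32} depends on the deletion.
\<close>

section \<open>Searching for cliques\<close>

fun clique_free :: "nat \<Rightarrow> ('a \<Rightarrow> 'a \<Rightarrow> bool) \<Rightarrow> 'a list \<Rightarrow> bool" where
  "clique_free 0 E xs = False"
| "clique_free (Suc k) E [] = True"
| "clique_free (Suc k) E (x # xs) =
     (clique_free k E (filter (E x) xs) \<and> clique_free (Suc k) E xs)"

text \<open>
  A clique that contains the head of the list has its other elements among the neighbours of the
  head; every other clique lives in the tail.
\<close>
lemma clique_free_sound:
  assumes "clique_free k E xs" "K \<subseteq> set xs" "card K = k"
    and "\<And>u v. u \<in> K \<Longrightarrow> v \<in> K \<Longrightarrow> u \<noteq> v \<Longrightarrow> E u v"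
  shows False
  using assms
proof (induction k E xs arbitrary: K rule: clique_free.induct)
  case (1 E xs)
  then show ?case by simp
next
  case (2 k E)
  then show ?case by simp
next
  case (3 k E x xs)
  have fin: "finite K" using "3.prems"(2) finite_subset by blast
  show ?case
  proof (cases "x \<in> K")
    case True
    have "K - {x} \<subseteq> set (filter (E x) xs)" using "3.prems"(2,4) True by auto
    moreover have "card (K - {x}) = k" using "3.prems"(3) True fin by simp
    ultimately show ?thesis using "3.IH"(1)[of "K - {x}"] "3.prems"(1,4) by auto
  next
    case False
    then have "K \<subseteq> set xs" using "3.prems"(2) by auto
    then show ?thesis using "3.IH"(2)[of K] "3.prems"(1,3,4) by auto
  qed
qed

section \<open>Rotating Cyclic(43)\<close>

text \<open>
  The residues are the ten blue distances and their negatives. Working with the residue of a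
  difference instead of a distance makes invariance under rotation immediate.
\<close>
definition cyc_blue :: "int \<Rightarrow> int \<Rightarrow> bool" where
  "cyc_blue u v \<longleftrightarrow> (v - u) mod 43 \<in> set
     [3, 4, 5, 6, 8, 9, 11, 15, 17, 19, 24, 26, 28, 32, 34, 35, 37, 38, 39, 40]"

lemma blue_cyclic43_iff:
  assumes "u \<in> {0..42}" "v \<in> {0..42}" "u \<noteq> v"
  shows "{u, v} \<in> blue cyclic43 \<longleftrightarrow> cyc_blue u v"
proof -
  define r where "r = (v - u) mod 43"
  have r_eq: "r = (if u < v then v - u else v - u + 43)"
  proof (cases "u < v")
    case True
    then show ?thesis using assms by (simp add: r_def)
  next
    case False
    have "r = (v - u + 43) mod 43" by (simp add: r_def)
    also have "\<dots> = v - u + 43" using False assms by (intro mod_pos_pos_trivial) auto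
    finally show ?thesis using False by simp
  qed
  then have "min \<bar>u - v\<bar> (43 - \<bar>u - v\<bar>) = min r (43 - r)" by auto
  then have "{u, v} \<in> blue cyclic43 \<longleftrightarrow>
      min r (43 - r) \<in> set [3, 4, 5, 6, 8, 9, 11, 15, 17, 19]"
    unfolding cyclic43_def by (simp add: edges43_iff[OF assms])
  moreover have "\<forall>r\<in>set [1..42].
      min r (43 - r) \<in> set [3, 4, 5, 6, 8, 9, 11, 15, 17, 19] \<longleftrightarrow> cyc_blue 0 r"
    by code_simp
  moreover have "r \<in> set [1..42]" using r_eq assms by (simp split: if_splits)
  moreover have "cyc_blue 0 r \<longleftrightarrow> cyc_blue u v" by (simp add: cyc_blue_def r_def)
  ultimately show ?thesis by metis
qed

lemma cyc_blue_rotate: "cyc_blue ((u - a) mod 43) ((v - a) mod 43) \<longleftrightarrow> cyc_blue u v"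
  by (simp add: cyc_blue_def mod_diff_eq)

text \<open>
  The part of a clique outside the given vertices a + g (g in G) is moved by the rotation by -a into
  the common neighbourhood of G, where it can be searched for. The list xs can be any list that is
  known to contain the rotated vertices.
\<close>
lemma no_clique_around:
  assumes free: "clique_free k cyc_blue (filter (\<lambda>x. \<forall>g\<in>set G. cyc_blue g x) xs)"
    and T: "T \<subseteq> {0..42}" "card T = k"
    and xs: "\<And>v. v \<in> T \<Longrightarrow> (v - a) mod 43 \<in> set xs"
    and clique: "\<And>u v. u \<in> T \<Longrightarrow> v \<in> T \<Longrightarrow> u \<noteq> v \<Longrightarrow> cyc_blue u v"
    and around: "\<And>g v. g \<in> set G \<Longrightarrow> v \<in> T \<Longrightarrow> cyc_blue (a + g) v"
  shows False
proof -
  define r where "r v = (v - a) mod 43" for v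
  have inj: "inj_on r T"
  proof (rule inj_onI)
    fix u v assume uv: "u \<in> T" "v \<in> T" "r u = r v"
    then have "(u - a + a) mod 43 = (v - a + a) mod 43"
      unfolding r_def by (metis mod_add_left_eq)
    then have "u mod 43 = v mod 43" by simp
    moreover have "u mod 43 = u" "v mod 43 = v"
      using T(1) uv(1,2) by (auto intro!: mod_pos_pos_trivial)
    ultimately show "u = v" by simp
  qed
  have sub: "r ` T \<subseteq> set (filter (\<lambda>x. \<forall>g\<in>set G. cyc_blue g x) xs)"
  proof clarify
    fix v assume v: "v \<in> T"
    have "r v \<in> set xs" using xs[OF v] by (simp add: r_def)
    moreover have "cyc_blue g (r v)" if "g \<in> set G" for g
      using around[OF that v] cyc_blue_rotate[of "a + g" a v]
      by (simp add: r_def cyc_blue_def mod_diff_eq mod_diff_right_eq algebra_simps)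
    ultimately show "r v \<in> set (filter (\<lambda>x. \<forall>g\<in>set G. cyc_blue g x) xs)" by simp
  qed
  have "card (r ` T) = k" using T(2) inj by (simp add: card_image)
  moreover have "cyc_blue x y" if xy: "x \<in> r ` T" "y \<in> r ` T" "x \<noteq> y" for x y
  proof -
    obtain u v where "u \<in> T" "v \<in> T" "x = r u" "y = r v" using xy(1,2) by blast
    moreover from this have "u \<noteq> v" using xy(3) by blast
    ultimately show ?thesis using clique unfolding r_def by (simp add: cyc_blue_rotate)
  qed
  ultimately show False by (rule clique_free_sound[OF free sub])
qed

lemma no_blue_K4_around_vertex:
  "clique_free 4 cyc_blue (filter (\<lambda>x. \<forall>g\<in>set [0]. cyc_blue g x) [0..42])"
  by code_simp

lemma no_blue_triangle_around_0_1:
  "clique_free 3 cyc_blue (filter (\<lambda>x. \<forall>g\<in>set [0, 1]. cyc_blue g x) [0..42])"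
  by code_simp

text \<open>
  The gap at 32 is essential: 6, 32 and 38 form a blue triangle in the common blue neighbourhood.
\<close>
lemma no_blue_triangle_around_0_21:
  "clique_free 3 cyc_blue (filter (\<lambda>x. \<forall>g\<in>set [0, 21]. cyc_blue g x) ([0..31] @ [33..42]))"
  by code_simp

section \<open>The recoloured edges\<close>

definition recoloured_pairs :: "(int \<times> int) list" where
  "recoloured_pairs = (11, 32) #
     map (\<lambda>a. (a, a + 1)) [4, 5, 6, 7, 13, 14, 15, 16, 23, 24, 30, 33, 39, 40, 41]"

definition exoo_blue :: "int \<Rightarrow> int \<Rightarrow> bool" where
  "exoo_blue u v \<longleftrightarrow>
     cyc_blue u v \<or> (u, v) \<in> set recoloured_pairs \<or> (v, u) \<in> set recoloured_pairs"

lemma blue_exoo42_iff: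
  assumes "u \<in> {1..42}" "v \<in> {1..42}" "u \<noteq> v"
  shows "{u, v} \<in> blue exoo42 \<longleftrightarrow> exoo_blue u v"
proof -
  have pairs: "exoo42_recoloured = (\<lambda>(a, b). {a, b}) ` set recoloured_pairs"
    by (simp add: exoo42_recoloured_def recoloured_pairs_def)
  have "{u, v} \<in> exoo42_recoloured \<longleftrightarrow>
      (\<exists>(a, b)\<in>set recoloured_pairs. {u, v} = {a, b})"
    unfolding pairs by (simp only: image_iff case_prod_unfold)
  also have "\<dots> \<longleftrightarrow> (u, v) \<in> set recoloured_pairs \<or> (v, u) \<in> set recoloured_pairs"
    unfolding doubleton_eq_iff by blast
  finally have "{u, v} \<in> exoo42_recoloured \<longleftrightarrow>
      (u, v) \<in> set recoloured_pairs \<or> (v, u) \<in> set recoloured_pairs" .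
  moreover have "{u, v} \<in> blue exoo42 \<longleftrightarrow>
      {u, v} \<in> blue cyclic43 \<or> {u, v} \<in> exoo42_recoloured"
    using assms by (simp add: exoo42_def recolour_blue_def delete_vertex_def)
  moreover have "{u, v} \<in> blue cyclic43 \<longleftrightarrow> cyc_blue u v"
    using assms by (intro blue_cyclic43_iff) auto
  ultimately show ?thesis by (simp only: exoo_blue_def)
qed

text \<open>
  Equality has to be admitted among the endpoints because two recoloured edges can share a vertex,
  as {4, 5} and {5, 6} do; then it is the edge between the outer endpoints that is red.
\<close>
lemma recoloured_pairs_isolated:
  assumes "(a, b) \<in> set recoloured_pairs" "(c, d) \<in> set recoloured_pairs"
    and clique: "\<forall>u\<in>set [a, b]. \<forall>v\<in>set [c, d]. u = v \<or> exoo_blue u v"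
  shows "(a, b) = (c, d)"
proof -
  have "\<forall>(a, b)\<in>set recoloured_pairs. \<forall>(c, d)\<in>set recoloured_pairs.
      (a, b) = (c, d) \<or> \<not> (\<forall>u\<in>set [a, b]. \<forall>v\<in>set [c, d]. u = v \<or> exoo_blue u v)"
    by code_simp
  from bspec[OF this assms(1)]
  have "\<forall>(c, d)\<in>set recoloured_pairs.
      (a, b) = (c, d) \<or> \<not> (\<forall>u\<in>set [a, b]. \<forall>v\<in>set [c, d]. u = v \<or> exoo_blue u v)"
    by (simp only: prod.case)
  from bspec[OF this assms(2)] show ?thesis using clique by (simp only: prod.case) blast
qed

lemma recoloured_pairs_difference:
  assumes "(a, b) \<in> set recoloured_pairs"
  shows "b = a + 1 \<or> a = 11 \<and> b = a + 21"
  using assms by (auto simp: recoloured_pairs_def)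

theorem mainTheorem2:
  shows "\<not> (\<exists>S. is_blue_K5 exoo42 S)"
proof
  assume "\<exists>S. is_blue_K5 exoo42 S"
  then obtain S where K5: "is_blue_K5 exoo42 S" ..
  then have S: "S \<subseteq> {1..42}" "card S = 5"
    unfolding is_blue_K5_def vertices_exoo42 by blast+
  have blue: "exoo_blue u v" if "u \<in> S" "v \<in> S" "u \<noteq> v" for u v
  proof -
    have "{u, v} \<in> blue exoo42" using K5 that unfolding is_blue_K5_def by blast
    moreover have "u \<in> {1..42}" "v \<in> {1..42}" using S(1) that by blast+
    ultimately show ?thesis using that(3) blue_exoo42_iff by blast
  qed
  have residue: "x mod 43 \<in> set [0..42]" for x :: int
    using pos_mod_bound[of 43 x] by simp
  have fin: "finite S" using S(1) finite_subset by blast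
  show False
  proof (cases "\<exists>a b. (a, b) \<in> set recoloured_pairs \<and> a \<in> S \<and> b \<in> S")
    case False
    then have cyc: "cyc_blue u v" if "u \<in> S" "v \<in> S" "u \<noteq> v" for u v
      using blue[OF that] that unfolding exoo_blue_def by blast
    obtain a where a: "a \<in> S" using S(2) by fastforce
    show False
    proof (rule no_clique_around[OF no_blue_K4_around_vertex, where T = "S - {a}" and a = a])
      show "(v - a) mod 43 \<in> set [0..42]" for v by (rule residue)
      show "S - {a} \<subseteq> {0..42}" using S(1) by auto
      show "card (S - {a}) = 4" using a S(2) fin by simp
    qed (use a cyc in auto)
  next
    case True
    then obtain a b where ab: "(a, b) \<in> set recoloured_pairs" "a \<in> S" "b \<in> S" by blast
    have cyc: "cyc_blue u v" if uv: "u \<in> S" "v \<in> S" "u \<noteq> v" "v \<notin> {a, b}" for u v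
    proof -
      have "\<not> (c \<in> S \<and> d \<in> S)"
        if "(c, d) \<in> set recoloured_pairs" "(c, d) \<noteq> (a, b)" for c d
      proof
        assume "c \<in> S \<and> d \<in> S"
        then have "\<forall>x\<in>set [a, b]. \<forall>y\<in>set [c, d]. x = y \<or> exoo_blue x y"
          using blue ab(2,3) by auto
        then show False
          using recoloured_pairs_isolated[OF ab(1) that(1)] that(2) by simp
      qed
      moreover have "(u, v) \<noteq> (a, b)" "(v, u) \<noteq> (a, b)" using uv(4) by auto
      ultimately show ?thesis using blue[OF uv(1-3)] uv(1,2) unfolding exoo_blue_def by blast
    qed
    have impossible: False
      if b: "b = a + g" "a \<noteq> b"
        and xs: "\<And>v. v \<in> S \<Longrightarrow> (v - a) mod 43 \<in> set xs"
        and free: "clique_free 3 cyc_blue (filter (\<lambda>x. \<forall>h\<in>set [0, g]. cyc_blue h x) xs)" for g xs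
    proof (rule no_clique_around[OF free, where T = "S - {a, b}" and a = a])
      show "S - {a, b} \<subseteq> {0..42}" using S(1) by auto
      show "card (S - {a, b}) = 3" using ab b(2) S(2) fin by (simp add: card_Diff_subset)
      show "(v - a) mod 43 \<in> set xs" if "v \<in> S - {a, b}" for v using xs that by blast
    next
      fix h v assume h: "h \<in> set [0, g]" and v: "v \<in> S - {a, b}"
      have "a + h = a \<or> a + h = b" using h unfolding b(1) by auto
      moreover have "cyc_blue a v" "cyc_blue b v"
        using v ab(2,3) by (auto intro!: cyc)
      ultimately show "cyc_blue (a + h) v" by metis
    next
      fix u v assume "u \<in> S - {a, b}" "v \<in> S - {a, b}" "u \<noteq> v"
      then show "cyc_blue u v" by (intro cyc) auto
    qed
    from recoloured_pairs_difference[OF ab(1)] show False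
    proof
      assume "b = a + 1"
      then show False by (intro impossible[OF _ _ residue no_blue_triangle_around_0_1]) simp_all
    next
      assume 11: "a = 11 \<and> b = a + 21"
      have "(v - a) mod 43 \<in> set ([0..31] @ [33..42])" if "v \<in> S" for v
      proof -
        have "v \<in> {1..42}" using S(1) that by blast
        then have "(v - 11) mod 43 \<noteq> 32" unfolding atLeastAtMost_iff by presburger
        moreover have "0 \<le> (v - 11) mod 43" "(v - 11) mod 43 < 43" by simp_all
        ultimately show ?thesis
          unfolding 11[THEN conjunct1] set_append set_upto Un_iff atLeastAtMost_iff by linarith
      qed
      from impossible[OF _ _ this no_blue_triangle_around_0_21] show False using 11 by simp
    qed
  qed
qed

end
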